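(* Let $A=(B,C^s,C^t,\mathcal{B})$ be a dynamic contact algebra and let $A_+=(X^t_A,X^s_A,T_A,\prec_A,M_A)$ be its canonical dynamic mereotopological space. Then $A_+$ is a $T_0$ and DM-compact dynamic mereotopological space.
   Context: DCA: $B$ Boolean algebra with $0\neq1$; $C^s,C^t$ contact relations (precontact: $aCb\Rightarrow a,b\neq0$; upward monotone; $aC(b+c)\Rightarrow aCb\vee aCc$; $(a+b)Cc\Rightarrow aCc\vee bCc$; contact: additionally symmetric and $a\cdot b\neq0\Rightarrow aCb$); $\mathcal{B}$ precontact; $aC^sb\Rightarrow aC^tb$; $a\overline{C^t}b\Rightarrow\exists c(a\overline{C^t}c\wedge c^*\overline{C^t}b)$; $a\overline{\mathcal{B}}b\Rightarrow\exists c(a\overline{C^t}c\wedge c^*\overline{\mathcal{B}}b)$; $a\overline{\mathcal{B}}b\Rightarrow\exists c(a\overline{\mathcal{B}}c\wedge c^*\overline{C^t}b)$. t-clans (s-clans): $\Gamma\subseteq B$ with $1\in\Gamma$, $0\notin\Gamma$, upward closed, $a+b\in\Gamma\Rightarrow a\in\Gamma\vee b\in\Gamma$, and pairwise $C^t$- (resp. $C^s$-) related elements; clusters: t-clans $\Gamma$ with $\forall a\notin\Gamma\exists b\in\Gamma\,a\overline{C^t}b$. For t-clans, $\Gamma\prec_A\Delta$ iff $a\mathcal{B}b$ for all $a\in\Gamma,b\in\Delta$. Canonical space: $X^t_A$ = t-clans, $X^s_A$ = s-clans, $T_A$ = clusters of $A$, $g_A(a)=\{\Gamma\in X^t_A:a\in\Gamma\}$,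 $M_A=\{g_A(a):a\in B\}$, topology on $X^t_A$ with closed base $M_A$. A DMS is $S=(X^t,X^s,T,\prec,M)$ with $X^t$ a nonempty space, $M$ a Boolean subalgebra of the regular closed sets $RC(X^t)$ forming a closed base, $X^s,T$ nonempty subsets of $X^t$, every nonempty regular closed set meets $X^s$, $\prec$ on $X^t$; with $aC^tb$ iff $a\cap b\neq\emptyset$, $aC^sb$ iff $a\cap b\cap X^s\neq\emptyset$, $a\mathcal{B}b$ iff $\exists x\in a,y\in b\,x\prec y$, $S^+=(M,C^s,C^t,\mathcal{B})$, $\rho_S(x)=\{a\in M:x\in a\}$, requiring: $S^+$ is a DCA; $x\prec y$ iff $\forall a,b\in M(x\in a,y\in b\Rightarrow a\mathcal{B}b)$; $\rho_S(x)$ is a cluster of $S^+$ for $x\in T$. $S$ is $T_0$ if $X^t$ is; DM-compact if every t-clan, s-clan, cluster of $S^+$ is $\rho_S(x)$ for some $x$ in $X^t$, $X^s$, $T$ respectively. *)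

theory Defs
  imports "HOL-Analysis.Analysis" "HOL-Algebra.Congruence"
begin

section \<open>Boolean algebras on a carrier set\<close>

text \<open>
  The regions of a dynamic mereotopological space form a Boolean algebra whose carrier depends
  on the space, so the class \<^class>\<open>boolean_algebra\<close> does not suffice. The axioms below are those
  of \<^locale>\<open>abstract_boolean_algebra\<close>, relativised to the carrier.
\<close>

record 'a bool_alg = "'a partial_object" +
  bjoin :: "'a \<Rightarrow> 'a \<Rightarrow> 'a" (infixl "\<squnion>\<index>" 65)
  bmeet :: "'a \<Rightarrow> 'a \<Rightarrow> 'a" (infixl "\<sqinter>\<index>" 70)
  bcompl :: "'a \<Rightarrow> 'a" ("\<sim>\<index> _" [81] 80)
  bzero :: 'a ("\<zero>\<index>")
  bone :: 'a ("\<one>\<index>")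

locale bool_algebra =
  fixes B (structure)
  assumes join_closed: "\<lbrakk>x \<in> carrier B; y \<in> carrier B\<rbrakk> \<Longrightarrow> x \<squnion> y \<in> carrier B"
    and meet_closed: "\<lbrakk>x \<in> carrier B; y \<in> carrier B\<rbrakk> \<Longrightarrow> x \<sqinter> y \<in> carrier B"
    and compl_closed: "x \<in> carrier B \<Longrightarrow> \<sim> x \<in> carrier B"
    and zero_closed: "\<zero> \<in> carrier B"
    and one_closed: "\<one> \<in> carrier B"
    and join_assoc: "\<lbrakk>x \<in> carrier B; y \<in> carrier B; z \<in> carrier B\<rbrakk>
      \<Longrightarrow> (x \<squnion> y) \<squnion> z = x \<squnion> (y \<squnion> z)"
    and meet_assoc: "\<lbrakk>x \<in> carrier B; y \<in> carrier B; z \<in> carrier B\<rbrakk>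
      \<Longrightarrow> (x \<sqinter> y) \<sqinter> z = x \<sqinter> (y \<sqinter> z)"
    and join_comm: "\<lbrakk>x \<in> carrier B; y \<in> carrier B\<rbrakk> \<Longrightarrow> x \<squnion> y = y \<squnion> x"
    and meet_comm: "\<lbrakk>x \<in> carrier B; y \<in> carrier B\<rbrakk> \<Longrightarrow> x \<sqinter> y = y \<sqinter> x"
    and meet_join_distrib: "\<lbrakk>x \<in> carrier B; y \<in> carrier B; z \<in> carrier B\<rbrakk>
      \<Longrightarrow> x \<sqinter> (y \<squnion> z) = (x \<sqinter> y) \<squnion> (x \<sqinter> z)"
    and join_meet_distrib: "\<lbrakk>x \<in> carrier B; y \<in> carrier B; z \<in> carrier B\<rbrakk>
      \<Longrightarrow> x \<squnion> (y \<sqinter> z) = (x \<squnion> y) \<sqinter> (x \<squnion> z)"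
    and meet_one: "x \<in> carrier B \<Longrightarrow> x \<sqinter> \<one> = x"
    and join_zero: "x \<in> carrier B \<Longrightarrow> x \<squnion> \<zero> = x"
    and meet_compl: "x \<in> carrier B \<Longrightarrow> x \<sqinter> \<sim> x = \<zero>"
    and join_compl: "x \<in> carrier B \<Longrightarrow> x \<squnion> \<sim> x = \<one>"

definition bool_le :: "('a, 'm) bool_alg_scheme \<Rightarrow> 'a \<Rightarrow> 'a \<Rightarrow> bool" (infix "\<sqsubseteq>\<index>" 50)
  where "x \<sqsubseteq>\<^bsub>B\<^esub> y \<longleftrightarrow> x \<sqinter>\<^bsub>B\<^esub> y = x"

definition bool_subalgebra :: "'a set \<Rightarrow> ('a, 'm) bool_alg_scheme \<Rightarrow> bool"
  where "bool_subalgebra M B \<longleftrightarrow>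
    M \<subseteq> carrier B \<and> \<zero>\<^bsub>B\<^esub> \<in> M \<and> \<one>\<^bsub>B\<^esub> \<in> M \<and> (\<forall>x\<in>M. \<sim>\<^bsub>B\<^esub> x \<in> M) \<and>
    (\<forall>x\<in>M. \<forall>y\<in>M. x \<squnion>\<^bsub>B\<^esub> y \<in> M \<and> x \<sqinter>\<^bsub>B\<^esub> y \<in> M)"


section \<open>Dynamic contact algebras\<close>

text \<open>
  Relations on the carrier are predicates on the whole type; their values outside the carrier
  are never used.
\<close>

locale precontact = bool_algebra B for B (structure) +
  fixes R :: "'a \<Rightarrow> 'a \<Rightarrow> bool"
  assumes nonzero: "\<lbrakk>a \<in> carrier B; b \<in> carrier B; R a b\<rbrakk> \<Longrightarrow> a \<noteq> \<zero> \<and> b \<noteq> \<zero>"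
    and mono: "\<lbrakk>a \<in> carrier B; b \<in> carrier B; a' \<in> carrier B; b' \<in> carrier B;
      R a b; a \<sqsubseteq> a'; b \<sqsubseteq> b'\<rbrakk> \<Longrightarrow> R a' b'"
    and join_right: "\<lbrakk>a \<in> carrier B; b \<in> carrier B; c \<in> carrier B; R a (b \<squnion> c)\<rbrakk>
      \<Longrightarrow> R a b \<or> R a c"
    and join_left: "\<lbrakk>a \<in> carrier B; b \<in> carrier B; c \<in> carrier B; R (a \<squnion> b) c\<rbrakk>
      \<Longrightarrow> R a c \<or> R b c"

locale contact = precontact B R for B (structure) and R +
  assumes symmetric: "\<lbrakk>a \<in> carrier B; b \<in> carrier B; R a b\<rbrakk> \<Longrightarrow> R b a"
    and overlap: "\<lbrakk>a \<in> carrier B; b \<in> carrier B; a \<sqinter> b \<noteq> \<zero>\<rbrakk> \<Longrightarrow> R a b"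

text \<open>
  The fields \<open>Cs\<close>, \<open>Ct\<close> and \<open>Bp\<close> are $C^s$ (space contact), $C^t$ (time contact) and
  $\mathcal{B}$ (precedence).
\<close>

record 'a dyn_alg = "'a bool_alg" +
  Cs :: "'a \<Rightarrow> 'a \<Rightarrow> bool"
  Ct :: "'a \<Rightarrow> 'a \<Rightarrow> bool"
  Bp :: "'a \<Rightarrow> 'a \<Rightarrow> bool"

locale dynamic_contact_algebra =
  bool_algebra A + space: contact A "Cs A" + time: contact A "Ct A" + prec: precontact A "Bp A"
  for A (structure) +
  assumes zero_neq_one: "\<zero> \<noteq> \<one>"
    and Cs_imp_Ct: "\<lbrakk>a \<in> carrier A; b \<in> carrier A; Cs A a b\<rbrakk> \<Longrightarrow> Ct A a b"
    and Ct_Ct: "\<lbrakk>a \<in> carrier A; b \<in> carrier A; \<not> Ct A a b\<rbrakk>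
      \<Longrightarrow> \<exists>c\<in>carrier A. \<not> Ct A a c \<and> \<not> Ct A (\<sim> c) b"
    and Ct_Bp: "\<lbrakk>a \<in> carrier A; b \<in> carrier A; \<not> Bp A a b\<rbrakk>
      \<Longrightarrow> \<exists>c\<in>carrier A. \<not> Ct A a c \<and> \<not> Bp A (\<sim> c) b"
    and Bp_Ct: "\<lbrakk>a \<in> carrier A; b \<in> carrier A; \<not> Bp A a b\<rbrakk>
      \<Longrightarrow> \<exists>c\<in>carrier A. \<not> Bp A a c \<and> \<not> Ct A (\<sim> c) b"

definition clan :: "('a, 'm) bool_alg_scheme \<Rightarrow> ('a \<Rightarrow> 'a \<Rightarrow> bool) \<Rightarrow> 'a set \<Rightarrow> bool"
  where "clan B R \<Gamma> \<longleftrightarrow>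
    \<Gamma> \<subseteq> carrier B \<and> \<one>\<^bsub>B\<^esub> \<in> \<Gamma> \<and> \<zero>\<^bsub>B\<^esub> \<notin> \<Gamma> \<and>
    (\<forall>a\<in>\<Gamma>. \<forall>b\<in>carrier B. a \<sqsubseteq>\<^bsub>B\<^esub> b \<longrightarrow> b \<in> \<Gamma>) \<and>
    (\<forall>a\<in>carrier B. \<forall>b\<in>carrier B. a \<squnion>\<^bsub>B\<^esub> b \<in> \<Gamma> \<longrightarrow> a \<in> \<Gamma> \<or> b \<in> \<Gamma>) \<and>
    (\<forall>a\<in>\<Gamma>. \<forall>b\<in>\<Gamma>. R a b)"

definition t_clans :: "('a, 'm) dyn_alg_scheme \<Rightarrow> 'a set set"
  where "t_clans A = {\<Gamma>. clan A (Ct A) \<Gamma>}"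

definition s_clans :: "('a, 'm) dyn_alg_scheme \<Rightarrow> 'a set set"
  where "s_clans A = {\<Gamma>. clan A (Cs A) \<Gamma>}"

definition clusters :: "('a, 'm) dyn_alg_scheme \<Rightarrow> 'a set set"
  where "clusters A =
    {\<Gamma> \<in> t_clans A. \<forall>a \<in> carrier A - \<Gamma>. \<exists>b\<in>\<Gamma>. \<not> Ct A a b}"


section \<open>Dynamic mereotopological spaces\<close>

definition regular_closed :: "'p topology \<Rightarrow> 'p set \<Rightarrow> bool"
  where "regular_closed X a \<longleftrightarrow> a = X closure_of (X interior_of a)"

definition RC :: "'p topology \<Rightarrow> 'p set bool_alg"
  where "RC X =
    \<lparr>carrier = {a. regular_closed X a},
     bjoin = (\<lambda>a b. a \<union> b),
     bmeet = (\<lambda>a b. X closure_of (X interior_of (a \<inter> b))),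
     bcompl = (\<lambda>a. X closure_of (topspace X - a)),
     bzero = {},
     bone = topspace X\<rparr>"

text \<open>Intersecting with the whole space makes the empty intersection equal to the space.\<close>

definition closed_base :: "'p topology \<Rightarrow> 'p set set \<Rightarrow> bool"
  where "closed_base X M \<longleftrightarrow>
    (\<forall>a\<in>M. closedin X a) \<and>
    (\<forall>F. closedin X F \<longrightarrow> (\<exists>N\<subseteq>M. F = topspace X \<inter> \<Inter>N))"

text \<open>
  \<open>Xt\<close> is the topological space $X^t$, its set of points being \<open>topspace (Xt S)\<close>; \<open>XT\<close>,
  \<open>before\<close> and \<open>regions\<close> are $T$, $\prec$ and $M$. The values of \<open>before\<close> outside the space are
  never used.
\<close>

record 'p dm_struct =
  Xt :: "'p topology"
  Xs :: "'p set"
  XT :: "'p set"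
  before :: "'p \<Rightarrow> 'p \<Rightarrow> bool"
  regions :: "'p set set"

definition region_algebra :: "('p, 'm) dm_struct_scheme \<Rightarrow> 'p set dyn_alg"
  where "region_algebra S =
    \<lparr>carrier = regions S,
     bjoin = bjoin (RC (Xt S)),
     bmeet = bmeet (RC (Xt S)),
     bcompl = bcompl (RC (Xt S)),
     bzero = bzero (RC (Xt S)),
     bone = bone (RC (Xt S)),
     Cs = (\<lambda>a b. a \<inter> b \<inter> Xs S \<noteq> {}),
     Ct = (\<lambda>a b. a \<inter> b \<noteq> {}),
     Bp = (\<lambda>a b. \<exists>x\<in>a. \<exists>y\<in>b. before S x y)\<rparr>"

definition rho :: "('p, 'm) dm_struct_scheme \<Rightarrow> 'p \<Rightarrow> 'p set set"
  where "rho S x = {a \<in> regions S. x \<in> a}"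

locale dynamic_mereotopological_space =
  fixes S :: "('p, 'm) dm_struct_scheme"
  assumes Xt_nonempty: "topspace (Xt S) \<noteq> {}"
    and regions_subalgebra: "bool_subalgebra (regions S) (RC (Xt S))"
    and regions_closed_base: "closed_base (Xt S) (regions S)"
    and Xs_subset: "Xs S \<subseteq> topspace (Xt S)"
    and Xs_nonempty: "Xs S \<noteq> {}"
    and XT_subset: "XT S \<subseteq> topspace (Xt S)"
    and XT_nonempty: "XT S \<noteq> {}"
    and Xs_meets: "\<lbrakk>regular_closed (Xt S) a; a \<noteq> {}\<rbrakk> \<Longrightarrow> a \<inter> Xs S \<noteq> {}"
    and region_algebra_dca: "dynamic_contact_algebra (region_algebra S)"
    and before_iff: "\<lbrakk>x \<in> topspace (Xt S); y \<in> topspace (Xt S)\<rbrakk> \<Longrightarrow>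
      before S x y \<longleftrightarrow>
      (\<forall>a\<in>regions S. \<forall>b\<in>regions S. x \<in> a \<longrightarrow> y \<in> b \<longrightarrow> Bp (region_algebra S) a b)"
    and rho_cluster: "x \<in> XT S \<Longrightarrow> rho S x \<in> clusters (region_algebra S)"

definition DM_compact :: "('p, 'm) dm_struct_scheme \<Rightarrow> bool"
  where "DM_compact S \<longleftrightarrow>
    (\<forall>\<Gamma>\<in>t_clans (region_algebra S). \<exists>x\<in>topspace (Xt S). \<Gamma> = rho S x) \<and>
    (\<forall>\<Gamma>\<in>s_clans (region_algebra S). \<exists>x\<in>Xs S. \<Gamma> = rho S x) \<and>
    (\<forall>\<Gamma>\<in>clusters (region_algebra S). \<exists>x\<in>XT S. \<Gamma> = rho S x)"


section \<open>The canonical space of a dynamic contact algebra\<close>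

definition g_map :: "('a, 'm) dyn_alg_scheme \<Rightarrow> 'a \<Rightarrow> 'a set set"
  where "g_map A a = {\<Gamma> \<in> t_clans A. a \<in> \<Gamma>}"

text \<open>
  The coarsest topology making every \<open>g_map A a\<close> closed. For a dynamic contact algebra the sets
  \<open>g_map A a\<close> are closed under finite unions and include the empty set, so they form a closed base
  of it and its points are exactly the t-clans
  (\<open>closed_base_canonical_topology\<close> and \<open>topspace_canonical_topology\<close>).
\<close>

definition canonical_topology :: "('a, 'm) dyn_alg_scheme \<Rightarrow> 'a set topology"
  where "canonical_topology A = topology_generated_by {t_clans A - g_map A a | a. a \<in> carrier A}"

definition canonical_space :: "('a, 'm) dyn_alg_scheme \<Rightarrow> 'a set dm_struct"
  where "canonical_space A =
    \<lparr>Xt = canonical_topology A,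
     Xs = s_clans A,
     XT = clusters A,
     before = (\<lambda>\<Gamma> \<Delta>. \<forall>a\<in>\<Gamma>. \<forall>b\<in>\<Delta>. Bp A a b),
     regions = g_map A ` carrier A\<rparr>"

context dynamic_contact_algebra
begin

lemma topspace_canonical_topology: "topspace (canonical_topology A) = t_clans A"
proof -
  have "t_clans A - g_map A \<zero> = t_clans A"
    by (auto simp: g_map_def t_clans_def clan_def)
  then show ?thesis
    unfolding canonical_topology_def topology_generated_by_topspace
    using zero_closed by blast
qed

lemma join_absorb: "x \<sqinter> (x \<squnion> y) = x" if "x \<in> carrier A" "y \<in> carrier A"
proof -
  have z: "y \<sqinter> \<zero> = \<zero>" if "y \<in> carrier A" for y
  proof -
    have "y \<sqinter> \<zero> = (y \<sqinter> \<sim> y) \<squnion> (y \<sqinter> \<zero>)"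
      using that by (metis join_comm join_zero meet_closed meet_compl zero_closed)
    also have "\<dots> = y \<sqinter> (\<sim> y \<squnion> \<zero>)"
      using that by (simp add: meet_join_distrib compl_closed zero_closed)
    also have "\<dots> = \<zero>"
      using that by (simp add: join_zero compl_closed meet_compl)
    finally show ?thesis .
  qed
  have "x \<sqinter> (x \<squnion> y) = (x \<squnion> \<zero>) \<sqinter> (x \<squnion> y)"
    using that by (simp add: join_zero)
  also have "\<dots> = x \<squnion> (\<zero> \<sqinter> y)"
    using that by (simp add: join_meet_distrib zero_closed)
  also have "\<dots> = x"
    using that z by (simp add: meet_comm zero_closed join_zero)
  finally show ?thesis .
qed

lemma g_join: "g_map A (a \<squnion> b) = g_map A a \<union> g_map A b" if "a \<in> carrier A" "b \<in> carrier A"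
proof -
  have "a \<sqsubseteq> a \<squnion> b" "b \<sqsubseteq> a \<squnion> b"
    using that join_absorb[of a b] join_absorb[of b a] by (auto simp: bool_le_def join_comm)
  then show ?thesis
    using that join_closed[of a b] unfolding g_map_def t_clans_def clan_def by blast
qed

lemma closed_base_canonical_topology: "closed_base (canonical_topology A) (g_map A ` carrier A)"
proof -
  have base: "\<exists>N\<subseteq>carrier A. U = (\<Union>a\<in>N. t_clans A - g_map A a)"
    if "generate_topology_on {t_clans A - g_map A a | a. a \<in> carrier A} U" for U
    using that
  proof induction
    case Empty
    then show ?case by (intro exI[of _ "{}"]) auto
  next
    case (Int U V)
    then obtain N P where NP: "N \<subseteq> carrier A" "U = (\<Union>a\<in>N. t_clans A - g_map A a)"
      "P \<subseteq> carrier A" "V = (\<Union>a\<in>P. t_clans A - g_map A a)"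
      by blast
    let ?Q = "{a \<squnion> b | a b. a \<in> N \<and> b \<in> P}"
    have gj: "g_map A (a \<squnion> b) = g_map A a \<union> g_map A b" if "a \<in> N" "b \<in> P" for a b
      using that NP g_join by blast
    have "U \<inter> V = (\<Union>a\<in>?Q. t_clans A - g_map A a)"
    proof (rule Set.set_eqI)
      fix \<Gamma>
      have "\<Gamma> \<in> (\<Union>a\<in>?Q. t_clans A - g_map A a) \<longleftrightarrow>
        (\<exists>a\<in>N. \<exists>b\<in>P. \<Gamma> \<in> t_clans A \<and> \<Gamma> \<notin> g_map A (a \<squnion> b))"
        by blast
      also have "\<dots> \<longleftrightarrow> (\<exists>a\<in>N. \<exists>b\<in>P. \<Gamma> \<in> t_clans A \<and> \<Gamma> \<notin> g_map A a \<and> \<Gamma> \<notin> g_map A b)"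
        using gj by simp
      also have "\<dots> \<longleftrightarrow> \<Gamma> \<in> U \<inter> V"
        unfolding NP by blast
      finally show "\<Gamma> \<in> U \<inter> V \<longleftrightarrow> \<Gamma> \<in> (\<Union>a\<in>?Q. t_clans A - g_map A a)" by simp
    qed
    moreover have "?Q \<subseteq> carrier A"
      using NP join_closed by blast
    ultimately show ?case by blast
  next
    case (UN K)
    let ?N = "{a \<in> carrier A. t_clans A - g_map A a \<subseteq> \<Union>K}"
    have "\<Union>K \<subseteq> (\<Union>a\<in>?N. t_clans A - g_map A a)"
    proof
      fix \<Gamma> assume "\<Gamma> \<in> \<Union>K"
      then obtain k where k: "k \<in> K" "\<Gamma> \<in> k" by blast
      from UN.IH[OF k(1)] obtain N
        where N: "N \<subseteq> carrier A" "k = (\<Union>a\<in>N. t_clans A - g_map A a)"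
        by blast
      from k(2) N(2) obtain a where a: "a \<in> N" "\<Gamma> \<in> t_clans A - g_map A a" by blast
      moreover have "t_clans A - g_map A a \<subseteq> k"
        unfolding N(2) using a(1) by (rule UN_upper)
      ultimately show "\<Gamma> \<in> (\<Union>a\<in>?N. t_clans A - g_map A a)"
        using k(1) N(1) by blast
    qed
    then have "\<Union>K = (\<Union>a\<in>?N. t_clans A - g_map A a)"
      by (intro equalityI) auto
    then show ?case by (intro exI[of _ ?N]) simp
  next
    case (Basis U)
    then obtain a where "a \<in> carrier A" "U = t_clans A - g_map A a" by blast
    then show ?case by (intro exI[of _ "{a}"]) auto
  qed
  have "closedin (canonical_topology A) (g_map A a)" if "a \<in> carrier A" for a
  proof -
    have "openin (canonical_topology A) (t_clans A - g_map A a)"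
      unfolding canonical_topology_def using that by (intro topology_generated_by_Basis) blast
    then show ?thesis
      unfolding closedin_def topspace_canonical_topology by (auto simp: g_map_def)
  qed
  moreover have "\<exists>N\<subseteq>g_map A ` carrier A. F = topspace (canonical_topology A) \<inter> \<Inter>N"
    if "closedin (canonical_topology A) F" for F
  proof -
    have F: "F \<subseteq> t_clans A" "openin (canonical_topology A) (t_clans A - F)"
      using that by (auto simp: closedin_def topspace_canonical_topology)
    from F(2) have "generate_topology_on {t_clans A - g_map A a | a. a \<in> carrier A} (t_clans A - F)"
      unfolding canonical_topology_def openin_topology_generated_by_iff .
    from base[OF this]
    obtain N where N: "N \<subseteq> carrier A" "t_clans A - F = (\<Union>a\<in>N. t_clans A - g_map A a)"
      by (elim exE conjE)
    have "F = t_clans A - (t_clans A - F)"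
      using F(1) by (simp add: double_diff)
    also have "\<dots> = t_clans A \<inter> \<Inter>(g_map A ` N)"
      unfolding N(2) by auto
    finally show ?thesis
      using N(1) unfolding topspace_canonical_topology
      by (intro exI[of _ "g_map A ` N"]) (simp add: image_mono)
  qed
  ultimately show ?thesis
    by (auto simp: closed_base_def)
qed

end

end

theory Submission
  imports Defs
begin

text \<open>
  Stone duality. A prime filter is both a t-clan and an s-clan, and a precontact relation holds
  between two elements iff it holds throughout $U \times V$ for some prime filters $U$, $V$
  containing them: a counterexample ideal for one argument is avoided first, then one for the
  other. For a contact relation $U \cup V$ is then a clan. Hence \<open>g_map A\<close> is an isomorphism of $A$
  onto the algebra of regions, the closure of the complement of \<open>g_map A a\<close> being \<open>g_map A (\<sim> a)\<close>,
  and every other requirement transfers along it; clusters exist because the elements in time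
  contact with all members of a prime filter form one, by the interpolation axiom for $C^t$.
\<close>

section \<open>Order calculus of a Boolean algebra relativised to its carrier\<close>

context bool_algebra
begin

lemmas closed = join_closed meet_closed compl_closed zero_closed one_closed

lemma meet_idem: "x \<in> carrier B \<Longrightarrow> x \<sqinter> x = x"
  by (metis closed join_compl join_zero meet_compl meet_join_distrib meet_one)

lemma meet_zero: "x \<in> carrier B \<Longrightarrow> x \<sqinter> \<zero> = \<zero>"
  by (metis closed meet_assoc meet_idem meet_compl)

lemma meet_join_absorb: "\<lbrakk>x \<in> carrier B; y \<in> carrier B\<rbrakk> \<Longrightarrow> x \<sqinter> (x \<squnion> y) = x"
  by (metis closed join_meet_distrib join_zero meet_comm meet_zero)

lemma bool_le_refl: "x \<in> carrier B \<Longrightarrow> x \<sqsubseteq> x"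
  by (simp add: bool_le_def meet_idem)

lemma bool_le_trans:
  "\<lbrakk>x \<in> carrier B; y \<in> carrier B; z \<in> carrier B; x \<sqsubseteq> y; y \<sqsubseteq> z\<rbrakk> \<Longrightarrow> x \<sqsubseteq> z"
  by (metis bool_le_def meet_assoc)

lemma bool_le_antisym: "\<lbrakk>x \<in> carrier B; y \<in> carrier B; x \<sqsubseteq> y; y \<sqsubseteq> x\<rbrakk> \<Longrightarrow> x = y"
  by (metis bool_le_def meet_comm)

lemma zero_le: "x \<in> carrier B \<Longrightarrow> \<zero> \<sqsubseteq> x"
  by (simp add: bool_le_def meet_comm meet_zero zero_closed)

lemma le_one: "x \<in> carrier B \<Longrightarrow> x \<sqsubseteq> \<one>"
  by (simp add: bool_le_def meet_one)

lemma meet_le1: "\<lbrakk>x \<in> carrier B; y \<in> carrier B\<rbrakk> \<Longrightarrow> x \<sqinter> y \<sqsubseteq> x"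
  by (metis bool_le_def meet_assoc meet_closed meet_comm meet_idem)

lemma meet_le2: "\<lbrakk>x \<in> carrier B; y \<in> carrier B\<rbrakk> \<Longrightarrow> x \<sqinter> y \<sqsubseteq> y"
  by (metis meet_comm meet_le1)

lemma le_meetI:
  "\<lbrakk>x \<in> carrier B; y \<in> carrier B; z \<in> carrier B; z \<sqsubseteq> x; z \<sqsubseteq> y\<rbrakk> \<Longrightarrow> z \<sqsubseteq> x \<sqinter> y"
  by (metis bool_le_def meet_assoc)

lemma le_join1: "\<lbrakk>x \<in> carrier B; y \<in> carrier B\<rbrakk> \<Longrightarrow> x \<sqsubseteq> x \<squnion> y"
  by (simp add: bool_le_def meet_join_absorb)

lemma le_join2: "\<lbrakk>x \<in> carrier B; y \<in> carrier B\<rbrakk> \<Longrightarrow> y \<sqsubseteq> x \<squnion> y"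
  by (metis join_comm le_join1)

lemma join_leI:
  "\<lbrakk>x \<in> carrier B; y \<in> carrier B; z \<in> carrier B; x \<sqsubseteq> z; y \<sqsubseteq> z\<rbrakk> \<Longrightarrow> x \<squnion> y \<sqsubseteq> z"
  by (metis bool_le_def join_closed meet_comm meet_join_distrib)

lemma join_mono:
  assumes "x \<in> carrier B" "y \<in> carrier B" "x' \<in> carrier B" "y' \<in> carrier B"
    and "x \<sqsubseteq> x'" "y \<sqsubseteq> y'"
  shows "x \<squnion> y \<sqsubseteq> x' \<squnion> y'"
proof (rule join_leI)
  show "x \<sqsubseteq> x' \<squnion> y'"
    using assms bool_le_trans[of x x' "x' \<squnion> y'"] by (simp add: closed le_join1)
  show "y \<sqsubseteq> x' \<squnion> y'"
    using assms bool_le_trans[of y y' "x' \<squnion> y'"] by (simp add: closed le_join2)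
qed (use assms closed in auto)

text \<open>Splitting \<open>x\<close> along \<open>y\<close> and \<open>\<sim> y\<close> leaves
  only the part inside \<open>y\<close>. Contrapositively, a failing inequality yields a nonzero
  element for a prime filter to contain.\<close>

lemma le_of_meet_compl_zero:
  assumes "x \<in> carrier B" "y \<in> carrier B" "x \<sqinter> \<sim> y = \<zero>"
  shows "x \<sqsubseteq> y"
proof -
  have "x = (x \<sqinter> y) \<squnion> (x \<sqinter> \<sim> y)"
    using assms by (metis closed(3) join_compl meet_join_distrib meet_one)
  then show ?thesis
    using assms by (simp add: bool_le_def join_zero meet_closed)
qed


subsection \<open>Prime filters\<close>

text \<open>Properness is left out: whenever a prime filter is built, the element to be kept outside
  the ideal supplies it.\<close>

definition bool_ideal :: "'a set \<Rightarrow> bool"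
  where "bool_ideal I \<longleftrightarrow> I \<subseteq> carrier B \<and> \<zero> \<in> I \<and>
    (\<forall>x\<in>I. \<forall>y\<in>carrier B. y \<sqsubseteq> x \<longrightarrow> y \<in> I) \<and> (\<forall>x\<in>I. \<forall>y\<in>I. x \<squnion> y \<in> I)"

text \<open>These are the ultrafilters. Primeness is stated for joins so that it matches the join
  clause of \<open>clan\<close> literally.\<close>

definition prime_filter :: "'a set \<Rightarrow> bool"
  where "prime_filter U \<longleftrightarrow> U \<subseteq> carrier B \<and> \<one> \<in> U \<and> \<zero> \<notin> U \<and>
    (\<forall>x\<in>U. \<forall>y\<in>carrier B. x \<sqsubseteq> y \<longrightarrow> y \<in> U) \<and> (\<forall>x\<in>U. \<forall>y\<in>U. x \<sqinter> y \<in> U) \<and>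
    (\<forall>x\<in>carrier B. \<forall>y\<in>carrier B. x \<squnion> y \<in> U \<longrightarrow> x \<in> U \<or> y \<in> U)"

lemma bool_ideal_zero: "bool_ideal {\<zero>}"
  unfolding bool_ideal_def using closed zero_le bool_le_antisym join_zero by simp

text \<open>Two elements of the union lie in the larger of their two ideals, hence so does their
  join. This gives the upper bounds for Zorn's lemma.\<close>

lemma bool_ideal_Union:
  assumes "C \<noteq> {}" "\<And>I. I \<in> C \<Longrightarrow> bool_ideal I"
    and chain: "\<And>I J. \<lbrakk>I \<in> C; J \<in> C\<rbrakk> \<Longrightarrow> I \<subseteq> J \<or> J \<subseteq> I"
  shows "bool_ideal (\<Union>C)"
proof -
  have "x \<squnion> y \<in> \<Union>C" if "I \<in> C" "x \<in> I" "J \<in> C" "y \<in> J" for x y I J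
    using chain[OF that(1,3)] that assms(2) unfolding bool_ideal_def by (metis UnionI subsetD)
  moreover obtain I where "I \<in> C" using assms(1) by blast
  then have "\<zero> \<in> \<Union>C" using assms(2) unfolding bool_ideal_def by blast
  moreover have "\<Union>C \<subseteq> carrier B" using assms(2) unfolding bool_ideal_def by blast
  moreover have "y \<in> \<Union>C" if "I \<in> C" "x \<in> I" "y \<in> carrier B" "y \<sqsubseteq> x" for x y I
    using that assms(2)[OF that(1)] unfolding bool_ideal_def by blast
  ultimately show ?thesis
    unfolding bool_ideal_def by simp
qed

text \<open>This set is the ideal generated by \<open>J\<close> and \<open>x\<close>; since
  \<open>J\<close> is closed under joins, a single \<open>j\<close> bounds each element.\<close>

lemma bool_ideal_extend:
  assumes J: "bool_ideal J" and x: "x \<in> carrier B"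
  shows "bool_ideal {y \<in> carrier B. \<exists>j\<in>J. y \<sqsubseteq> j \<squnion> x}"
proof -
  have JB: "J \<subseteq> carrier B" and z: "\<zero> \<in> J" and jj: "\<And>j k. j \<in> J \<Longrightarrow> k \<in> J \<Longrightarrow> j \<squnion> k \<in> J"
    using J unfolding bool_ideal_def by auto
  have "\<exists>j\<in>J. y \<squnion> y' \<sqsubseteq> j \<squnion> x"
    if y: "y \<in> carrier B" "y' \<in> carrier B" "j \<in> J" "y \<sqsubseteq> j \<squnion> x" "j' \<in> J" "y' \<sqsubseteq> j' \<squnion> x"
    for y y' j j'
  proof -
    have c: "j \<in> carrier B" "j' \<in> carrier B" using y JB by auto
    have u: "j \<squnion> x \<sqsubseteq> (j \<squnion> j') \<squnion> x" "j' \<squnion> x \<sqsubseteq> (j \<squnion> j') \<squnion> x"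
      using c x by (simp_all add: join_mono closed le_join1 le_join2 bool_le_refl)
    then have "y \<squnion> y' \<sqsubseteq> (j \<squnion> j') \<squnion> x"
      using y c x bool_le_trans[of y "j \<squnion> x"] bool_le_trans[of y' "j' \<squnion> x"]
      by (simp add: closed join_leI)
    then show ?thesis using jj y by blast
  qed
  moreover have "\<exists>j\<in>J. \<zero> \<sqsubseteq> j \<squnion> x"
    using z x zero_le closed by blast
  moreover have "\<exists>j\<in>J. y' \<sqsubseteq> j \<squnion> x"
    if "y \<in> carrier B" "y' \<in> carrier B" "j \<in> J" "y \<sqsubseteq> j \<squnion> x" "y' \<sqsubseteq> y" for y y' j
    using that JB x bool_le_trans[of y' y "j \<squnion> x"] join_closed by blast
  ultimately show ?thesis
    unfolding bool_ideal_def using closed by (simp, blast)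
qed

text \<open>Take the complement of an ideal maximal among those that contain \<open>I\<close> and
  omit \<open>a\<close>; maximality is what makes the complement closed under meets.\<close>

lemma prime_filter_exists:
  assumes I: "bool_ideal I" and a: "a \<in> carrier B" "a \<notin> I"
  obtains U where "prime_filter U" "a \<in> U" "U \<inter> I = {}"
proof -
  let ?A = "{J. bool_ideal J \<and> I \<subseteq> J \<and> a \<notin> J}"
  have "\<exists>M\<in>?A. \<forall>X\<in>?A. M \<subseteq> X \<longrightarrow> X = M"
  proof (rule subset_Zorn_nonempty)
    show "?A \<noteq> {}" using assms by blast
    fix C assume C: "C \<noteq> {}" "subset.chain ?A C"
    then have "bool_ideal (\<Union>C)"
      by (intro bool_ideal_Union) (auto simp: subset.chain_def)
    then show "\<Union>C \<in> ?A"
      using C by (auto simp: subset.chain_def)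
  qed
  then obtain J where "J \<in> ?A" and J_max: "\<forall>X\<in>?A. J \<subseteq> X \<longrightarrow> X = J"
    by (rule bexE)
  then have J: "bool_ideal J" "I \<subseteq> J" "a \<notin> J"
    by simp_all
  have max: "K = J" if "bool_ideal K" "a \<notin> K" "J \<subseteq> K" for K
    using J_max that J(2) by simp
  have JB: "J \<subseteq> carrier B" and z: "\<zero> \<in> J"
    and jj: "\<And>j k. j \<in> J \<Longrightarrow> k \<in> J \<Longrightarrow> j \<squnion> k \<in> J"
    and jd: "\<And>j k. j \<in> J \<Longrightarrow> k \<in> carrier B \<Longrightarrow> k \<sqsubseteq> j \<Longrightarrow> k \<in> J"
    using J unfolding bool_ideal_def by auto
  \<comment> \<open>An ideal properly extending \<open>J\<close> must contain \<open>a\<close>, in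
    particular the one generated by \<open>J\<close> and \<open>x\<close>.\<close>
  have ext: "\<exists>j\<in>J. a \<sqsubseteq> j \<squnion> x" if x: "x \<in> carrier B" "x \<notin> J" for x
  proof (rule ccontr)
    assume n: "\<not> ?thesis"
    let ?K = "{y \<in> carrier B. \<exists>j\<in>J. y \<sqsubseteq> j \<squnion> x}"
    have "J \<subseteq> ?K" using JB le_join1 x by blast
    moreover have "a \<notin> ?K" using n by simp
    ultimately have "?K = J"
      using max[OF bool_ideal_extend[OF J(1) x(1)]] by simp
    moreover have "x \<in> ?K" using z x le_join2[of \<zero> x] zero_closed by auto
    ultimately show False
      using x(2) by simp
  qed
  \<comment> \<open>With one common bound \<open>j \<squnion> k\<close> for both elements,
    distributivity puts \<open>a\<close> below
    \<open>(j \<squnion> k) \<squnion> (x \<sqinter> y)\<close>, which would belong to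
    \<open>J\<close>.\<close>
  have meet: "x \<sqinter> y \<notin> J" if x: "x \<in> carrier B" "x \<notin> J" and y: "y \<in> carrier B" "y \<notin> J" for x y
  proof
    assume m: "x \<sqinter> y \<in> J"
    obtain j k where jk: "j \<in> J" "a \<sqsubseteq> j \<squnion> x" "k \<in> J" "a \<sqsubseteq> k \<squnion> y"
      using ext x y by blast
    then have c: "j \<in> carrier B" "k \<in> carrier B" using JB by auto
    have "j \<squnion> x \<sqsubseteq> (j \<squnion> k) \<squnion> x" "k \<squnion> y \<sqsubseteq> (j \<squnion> k) \<squnion> y"
      using c x y by (simp_all add: join_mono closed le_join1 le_join2 bool_le_refl)
    then have "a \<sqsubseteq> (j \<squnion> k) \<squnion> x" "a \<sqsubseteq> (j \<squnion> k) \<squnion> y"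
      using jk c x y a bool_le_trans[of a "j \<squnion> x"] bool_le_trans[of a "k \<squnion> y"]
      by (simp_all add: closed)
    then have "a \<sqsubseteq> ((j \<squnion> k) \<squnion> x) \<sqinter> ((j \<squnion> k) \<squnion> y)"
      using c x y a by (simp add: closed le_meetI)
    then have "a \<sqsubseteq> (j \<squnion> k) \<squnion> (x \<sqinter> y)"
      using c x y by (simp add: join_meet_distrib closed)
    then show False
      using jj jd jk m a J by blast
  qed
  have "prime_filter (carrier B - J)"
    unfolding prime_filter_def
  proof (intro conjI)
    show "\<one> \<in> carrier B - J" using jd[of \<one> a] le_one a J one_closed by auto
    show "\<forall>x\<in>carrier B - J. \<forall>y\<in>carrier B. x \<sqsubseteq> y \<longrightarrow> y \<in> carrier B - J" using jd by blast
  qed (use z jj meet closed in auto)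
  then show ?thesis
    using that[of "carrier B - J"] J a by blast
qed

lemma prime_filter_above:
  assumes "a \<in> carrier B" "a \<noteq> \<zero>"
  obtains U where "prime_filter U" "a \<in> U"
proof (rule prime_filter_exists[OF bool_ideal_zero assms(1)])
qed (use assms(2) that in auto)

lemma prime_filter_subset: "prime_filter U \<Longrightarrow> U \<subseteq> carrier B"
  by (simp add: prime_filter_def)

lemma prime_filter_up:
  "\<lbrakk>prime_filter U; x \<in> U; y \<in> carrier B; x \<sqsubseteq> y\<rbrakk> \<Longrightarrow> y \<in> U"
  by (simp add: prime_filter_def)

lemma prime_filter_meet: "\<lbrakk>prime_filter U; x \<in> U; y \<in> U\<rbrakk> \<Longrightarrow> x \<sqinter> y \<in> U"
  by (simp add: prime_filter_def)

lemma prime_filter_prime: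
  "\<lbrakk>prime_filter U; x \<squnion> y \<in> U; x \<in> carrier B; y \<in> carrier B\<rbrakk> \<Longrightarrow> x \<in> U \<or> y \<in> U"
  by (simp add: prime_filter_def)

lemma prime_filter_meet_iff:
  assumes U: "prime_filter U" and x: "x \<in> carrier B" and y: "y \<in> carrier B"
  shows "x \<sqinter> y \<in> U \<longleftrightarrow> x \<in> U \<and> y \<in> U"
proof (intro iffI conjI)
  assume *: "x \<sqinter> y \<in> U"
  show "x \<in> U" by (rule prime_filter_up[OF U * x meet_le1[OF x y]])
  show "y \<in> U" by (rule prime_filter_up[OF U * y meet_le2[OF x y]])
qed (simp add: prime_filter_meet[OF U])

lemma prime_filter_join_iff:
  assumes U: "prime_filter U" and x: "x \<in> carrier B" and y: "y \<in> carrier B"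
  shows "x \<squnion> y \<in> U \<longleftrightarrow> x \<in> U \<or> y \<in> U"
proof (intro iffI; (elim disjE)?)
  show "x \<in> U \<Longrightarrow> x \<squnion> y \<in> U"
    by (rule prime_filter_up[OF U _ join_closed[OF x y] le_join1[OF x y]])
  show "y \<in> U \<Longrightarrow> x \<squnion> y \<in> U"
    by (rule prime_filter_up[OF U _ join_closed[OF x y] le_join2[OF x y]])
qed (rule prime_filter_prime[OF U _ x y])

lemma prime_filter_compl_iff:
  "\<lbrakk>prime_filter U; x \<in> carrier B\<rbrakk> \<Longrightarrow> \<sim> x \<in> U \<longleftrightarrow> x \<notin> U"
  using prime_filter_join_iff[of U x "\<sim> x"] prime_filter_meet_iff[of U x "\<sim> x"]
  by (auto simp: join_compl meet_compl compl_closed) (auto simp: prime_filter_def)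

text \<open>If the inequality fails, \<open>x \<sqinter> \<sim> y\<close> is nonzero, and a prime
  filter through it contains \<open>x\<close> but not \<open>y\<close>.\<close>

lemma le_iff_prime_filter:
  assumes "x \<in> carrier B" "y \<in> carrier B"
  shows "x \<sqsubseteq> y \<longleftrightarrow> (\<forall>U. prime_filter U \<longrightarrow> x \<in> U \<longrightarrow> y \<in> U)"
proof
  assume "x \<sqsubseteq> y" then show "\<forall>U. prime_filter U \<longrightarrow> x \<in> U \<longrightarrow> y \<in> U"
    using assms prime_filter_up by blast
next
  assume *: "\<forall>U. prime_filter U \<longrightarrow> x \<in> U \<longrightarrow> y \<in> U"
  have "x \<sqinter> \<sim> y = \<zero>"
  proof (rule ccontr)
    assume nz: "x \<sqinter> \<sim> y \<noteq> \<zero>"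
    have "x \<sqinter> \<sim> y \<in> carrier B" using assms closed by simp
    from prime_filter_above[OF this nz]
    obtain U where "prime_filter U" "x \<sqinter> \<sim> y \<in> U" .
    then show False
      using * assms by (auto simp: prime_filter_meet_iff prime_filter_compl_iff closed)
  qed
  then show "x \<sqsubseteq> y" using assms le_of_meet_compl_zero by blast
qed

text \<open>Boolean identities thereby reduce to propositional logic, as in the De Morgan law that
  follows.\<close>

lemma eq_iff_prime_filter:
  assumes "x \<in> carrier B" "y \<in> carrier B"
  shows "x = y \<longleftrightarrow> (\<forall>U. prime_filter U \<longrightarrow> x \<in> U \<longleftrightarrow> y \<in> U)"
  using assms bool_le_antisym[OF assms] by (auto simp: le_iff_prime_filter)

lemma compl_join_compl: "\<lbrakk>x \<in> carrier B; y \<in> carrier B\<rbrakk> \<Longrightarrow> \<sim> (\<sim> x \<squnion> \<sim> y) = x \<sqinter> y"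
  by (simp add: eq_iff_prime_filter prime_filter_compl_iff prime_filter_join_iff
      prime_filter_meet_iff closed)

end

section \<open>Prime filters witnessing precontact and contact relations\<close>

context precontact
begin

text \<open>Merges two witnesses of non-relation into their meet. Hence the elements unrelated to
  some member of a filter are closed under joins.\<close>

lemma not_rel_join_left:
  assumes "a \<in> carrier B" "b \<in> carrier B" "c \<in> carrier B" "d \<in> carrier B" "\<not> R a c" "\<not> R b d"
  shows "\<not> R (a \<squnion> b) (c \<sqinter> d)"
proof
  have c: "c \<sqinter> d \<in> carrier B" "c \<sqinter> d \<sqsubseteq> c" "c \<sqinter> d \<sqsubseteq> d"
    using assms meet_closed meet_le1 meet_le2 by auto
  assume "R (a \<squnion> b) (c \<sqinter> d)"
  then have "R a (c \<sqinter> d) \<or> R b (c \<sqinter> d)"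
    by (rule join_left[OF assms(1,2) c(1)])
  then show False
    using mono[of a "c \<sqinter> d" a c] mono[of b "c \<sqinter> d" b d] assms c bool_le_refl by auto
qed

lemma prime_filters_of_rel:
  assumes ab: "a \<in> carrier B" "b \<in> carrier B" "R a b"
  obtains U V where "prime_filter U" "prime_filter V" "a \<in> U" "b \<in> V" "\<forall>u\<in>U. \<forall>v\<in>V. R u v"
proof -
  \<comment> \<open>A filter \<open>V\<close> avoiding this ideal consists of elements all related
    to \<open>a\<close>.\<close>
  have "bool_ideal {c \<in> carrier B. \<not> R a c}"
    unfolding bool_ideal_def
  proof (intro conjI ballI impI)
    show "\<zero> \<in> {c \<in> carrier B. \<not> R a c}" using nonzero ab closed by blast
    fix x assume x: "x \<in> {c \<in> carrier B. \<not> R a c}"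
    fix y show "y \<in> {c \<in> carrier B. \<not> R a c}" if "y \<in> carrier B" "y \<sqsubseteq> x"
      using that x ab mono bool_le_refl by blast
    show "x \<squnion> y \<in> {c \<in> carrier B. \<not> R a c}" if "y \<in> {c \<in> carrier B. \<not> R a c}"
      using that x ab join_right closed by blast
  qed auto
  then obtain V where V: "prime_filter V" "b \<in> V" "V \<inter> {c \<in> carrier B. \<not> R a c} = {}"
    using prime_filter_exists ab by (metis (no_types, lifting) mem_Collect_eq)
  then have VB: "V \<subseteq> carrier B" unfolding prime_filter_def by blast
  \<comment> \<open>Letting the counterexample range over all of \<open>V\<close> ensures that a
    filter avoiding \<open>?I\<close> is related to every member of \<open>V\<close> at
    once.\<close>
  let ?I = "{c \<in> carrier B. \<exists>v\<in>V. \<not> R c v}"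
  have "bool_ideal ?I"
    unfolding bool_ideal_def
  proof (intro conjI ballI impI)
    show "\<zero> \<in> ?I" using nonzero ab closed VB V by blast
    fix x assume x: "x \<in> ?I"
    fix y show "y \<in> ?I" if "y \<in> carrier B" "y \<sqsubseteq> x"
      using that x ab mono bool_le_refl VB by blast
    show "x \<squnion> y \<in> ?I" if y: "y \<in> ?I"
    proof -
      obtain u v where "u \<in> V" "v \<in> V" "\<not> R x u" "\<not> R y v" using x y by blast
      moreover from this have "u \<sqinter> v \<in> V" using V unfolding prime_filter_def by blast
      ultimately show ?thesis
        using not_rel_join_left x y VB closed by blast
    qed
  qed auto
  moreover have "a \<notin> ?I" using V VB by blast
  ultimately obtain U where U: "prime_filter U" "a \<in> U" "U \<inter> ?I = {}"
    by (rule prime_filter_exists[OF _ ab(1)])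
  show ?thesis
    using U(3) prime_filter_subset[OF U(1)]
    by (intro that[OF U(1) V(1) U(2) V(2)]) auto
qed

end

context contact
begin

text \<open>The meet of two members is again a member, hence nonzero, so the two overlap.\<close>

lemma prime_filter_rel:
  assumes U: "prime_filter U" and x: "x \<in> U" and y: "y \<in> U"
  shows "R x y"
  using assms overlap unfolding prime_filter_def by (metis subsetD)

lemma prime_filter_clan: "prime_filter U \<Longrightarrow> clan B R U"
  using prime_filter_rel unfolding clan_def prime_filter_def by metis

text \<open>The clan is a union of two prime filters. Pairs across them are related by their choice
  and by symmetry, pairs within one by overlap. The union may fail to be closed under meets, which
  \<open>clan\<close> does not ask for.\<close>

lemma clan_of_rel:
  assumes "a \<in> carrier B" "b \<in> carrier B" "R a b"
  obtains \<Gamma> where "clan B R \<Gamma>" "a \<in> \<Gamma>" "b \<in> \<Gamma>"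
proof -
  obtain U V where UV: "prime_filter U" "prime_filter V" "a \<in> U" "b \<in> V" "\<forall>u\<in>U. \<forall>v\<in>V. R u v"
    using prime_filters_of_rel assms by blast
  then have "U \<subseteq> carrier B" "V \<subseteq> carrier B" unfolding prime_filter_def by auto
  then have "R x y" if "x \<in> U \<union> V" "y \<in> U \<union> V" for x y
    using that UV prime_filter_rel symmetric by blast
  moreover have "x \<in> U \<union> V" if "a \<in> U \<union> V" "x \<in> carrier B" "a \<sqsubseteq> x" for a x
    using that prime_filter_up[OF UV(1)] prime_filter_up[OF UV(2)] by blast
  moreover have "x \<in> U \<union> V \<or> y \<in> U \<union> V"
    if "x \<in> carrier B" "y \<in> carrier B" "x \<squnion> y \<in> U \<union> V" for x y
    using that prime_filter_prime[OF UV(1)] prime_filter_prime[OF UV(2)] by blast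
  moreover have "\<one> \<in> U \<union> V" "\<zero> \<notin> U \<union> V"
    using UV(1,2) by (auto simp: prime_filter_def)
  ultimately have "clan B R (U \<union> V)"
    using \<open>U \<subseteq> carrier B\<close> \<open>V \<subseteq> carrier B\<close> unfolding clan_def by simp
  then show ?thesis using that UV by blast
qed

end


subsection \<open>Isomorphisms of dynamic contact algebras\<close>

text \<open>The equations are oriented to pull the operations of \<open>A'\<close> inside
  \<open>h\<close>. Only \<open>A\<close> is assumed to be a dynamic contact algebra, so that the
  same for \<open>A'\<close> becomes a conclusion.\<close>

locale dyn_alg_iso =
  fixes A :: "('a, 'm) dyn_alg_scheme" and A' :: "('b, 'n) dyn_alg_scheme" and h :: "'a \<Rightarrow> 'b"
  assumes bij: "bij_betw h (carrier A) (carrier A')"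
    and join: "\<lbrakk>x \<in> carrier A; y \<in> carrier A\<rbrakk> \<Longrightarrow> h x \<squnion>\<^bsub>A'\<^esub> h y = h (x \<squnion>\<^bsub>A\<^esub> y)"
    and meet: "\<lbrakk>x \<in> carrier A; y \<in> carrier A\<rbrakk> \<Longrightarrow> h x \<sqinter>\<^bsub>A'\<^esub> h y = h (x \<sqinter>\<^bsub>A\<^esub> y)"
    and compl: "x \<in> carrier A \<Longrightarrow> \<sim>\<^bsub>A'\<^esub> (h x) = h (\<sim>\<^bsub>A\<^esub> x)"
    and zero: "\<zero>\<^bsub>A'\<^esub> = h \<zero>\<^bsub>A\<^esub>"
    and one: "\<one>\<^bsub>A'\<^esub> = h \<one>\<^bsub>A\<^esub>"
    and Cs: "\<lbrakk>x \<in> carrier A; y \<in> carrier A\<rbrakk> \<Longrightarrow> Cs A' (h x) (h y) = Cs A x y"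
    and Ct: "\<lbrakk>x \<in> carrier A; y \<in> carrier A\<rbrakk> \<Longrightarrow> Ct A' (h x) (h y) = Ct A x y"
    and Bp: "\<lbrakk>x \<in> carrier A; y \<in> carrier A\<rbrakk> \<Longrightarrow> Bp A' (h x) (h y) = Bp A x y"
    and dca: "dynamic_contact_algebra A"
begin

interpretation dynamic_contact_algebra A by (rule dca)

lemma carrier_image: "carrier A' = h ` carrier A"
  using bij by (simp add: bij_betw_def)

lemma map_eq_iff: "\<lbrakk>x \<in> carrier A; y \<in> carrier A\<rbrakk> \<Longrightarrow> h x = h y \<longleftrightarrow> x = y"
  using bij by (auto simp: bij_betw_def inj_on_def)

lemma map_le_iff: "\<lbrakk>x \<in> carrier A; y \<in> carrier A\<rbrakk> \<Longrightarrow> h x \<sqsubseteq>\<^bsub>A'\<^esub> h y \<longleftrightarrow> x \<sqsubseteq>\<^bsub>A\<^esub> y"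
  by (simp add: bool_le_def meet map_eq_iff closed)

lemma bool_algebra_image: "bool_algebra A'"
proof (unfold_locales, unfold carrier_image)
  show "x \<squnion>\<^bsub>A'\<^esub> y = y \<squnion>\<^bsub>A'\<^esub> x" "x \<sqinter>\<^bsub>A'\<^esub> y = y \<sqinter>\<^bsub>A'\<^esub> x"
    if "x \<in> h ` carrier A" "y \<in> h ` carrier A" for x y
    using that by (auto simp: join meet join_comm meet_comm)
  show "x \<sqinter>\<^bsub>A'\<^esub> (y \<squnion>\<^bsub>A'\<^esub> z) = (x \<sqinter>\<^bsub>A'\<^esub> y) \<squnion>\<^bsub>A'\<^esub> (x \<sqinter>\<^bsub>A'\<^esub> z)"
    if "x \<in> h ` carrier A" "y \<in> h ` carrier A" "z \<in> h ` carrier A" for x y z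
    using that by (auto simp: join meet closed meet_join_distrib)
  show "x \<squnion>\<^bsub>A'\<^esub> (y \<sqinter>\<^bsub>A'\<^esub> z) = (x \<squnion>\<^bsub>A'\<^esub> y) \<sqinter>\<^bsub>A'\<^esub> (x \<squnion>\<^bsub>A'\<^esub> z)"
    if "x \<in> h ` carrier A" "y \<in> h ` carrier A" "z \<in> h ` carrier A" for x y z
    using that by (auto simp: join meet closed join_meet_distrib)
qed (auto simp: join meet compl zero one closed join_assoc meet_assoc meet_one join_zero
    meet_compl join_compl)

text \<open>The relation is a parameter because the result serves all three relations, two of them
  through \<open>contact_image\<close>.\<close>

lemma precontact_image:
  assumes R: "precontact A R"
    and R': "\<And>x y. \<lbrakk>x \<in> carrier A; y \<in> carrier A\<rbrakk> \<Longrightarrow> R' (h x) (h y) = R x y"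
  shows "precontact A' R'"
proof -
  interpret R: precontact A R by (rule R)
  show ?thesis
  proof (intro precontact.intro bool_algebra_image, unfold_locales, unfold carrier_image)
    show "R' a' b'" if "a \<in> h ` carrier A" "b \<in> h ` carrier A" "a' \<in> h ` carrier A"
      "b' \<in> h ` carrier A" "R' a b" "a \<sqsubseteq>\<^bsub>A'\<^esub> a'" "b \<sqsubseteq>\<^bsub>A'\<^esub> b'" for a b a' b'
    proof -
      from that obtain w x y z where "a = h w" "b = h x" "a' = h y" "b' = h z"
        and c: "w \<in> carrier A" "x \<in> carrier A" "y \<in> carrier A" "z \<in> carrier A"
        by auto
      then show ?thesis
        using that R.mono[OF c] by (simp add: R' map_le_iff)
    qed
    show "R' a b \<or> R' a c" if "R' a (b \<squnion>\<^bsub>A'\<^esub> c)"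
      and "a \<in> h ` carrier A" "b \<in> h ` carrier A" "c \<in> h ` carrier A" for a b c
    proof -
      from that(2-) obtain x y z where "a = h x" "b = h y" "c = h z"
        and c: "x \<in> carrier A" "y \<in> carrier A" "z \<in> carrier A"
        by auto
      then show ?thesis
        using that(1) R.join_right[OF c] by (simp add: R' join closed)
    qed
    show "R' a c \<or> R' b c" if "R' (a \<squnion>\<^bsub>A'\<^esub> b) c"
      and "a \<in> h ` carrier A" "b \<in> h ` carrier A" "c \<in> h ` carrier A" for a b c
    proof -
      from that(2-) obtain x y z where "a = h x" "b = h y" "c = h z"
        and c: "x \<in> carrier A" "y \<in> carrier A" "z \<in> carrier A"
        by auto
      then show ?thesis
        using that(1) R.join_left[OF c] by (simp add: R' join closed)
    qed
  qed (auto simp: R' zero map_eq_iff closed dest: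
      R.nonzero[OF zero_closed] R.nonzero[OF _ zero_closed])
qed

lemma contact_image:
  assumes R: "contact A R"
    and R': "\<And>x y. \<lbrakk>x \<in> carrier A; y \<in> carrier A\<rbrakk> \<Longrightarrow> R' (h x) (h y) = R x y"
  shows "contact A' R'"
proof -
  interpret R: contact A R by (rule R)
  interpret R': precontact A' R' by (rule precontact_image[OF R.precontact_axioms R'])
  show ?thesis
    by (unfold_locales, unfold carrier_image)
      (auto simp: R' meet zero map_eq_iff closed dest: R.symmetric R.overlap)
qed

lemma dynamic_contact_algebra_image: "dynamic_contact_algebra A'"
proof -
  interpret S: contact A' "Cs A'" by (rule contact_image[OF space.contact_axioms Cs])
  interpret T: contact A' "Ct A'" by (rule contact_image[OF time.contact_axioms Ct])
  interpret P: precontact A' "Bp A'" by (rule precontact_image[OF prec.precontact_axioms Bp])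
  show ?thesis
  proof (unfold_locales, unfold carrier_image)
  qed (use zero_neq_one in \<open>auto simp: Cs Ct Bp compl zero one map_eq_iff closed
        dest: Cs_imp_Ct Ct_Ct Ct_Bp Bp_Ct\<close>)
qed

lemma mem_image_iff: "\<lbrakk>\<Gamma> \<subseteq> carrier A; x \<in> carrier A\<rbrakk> \<Longrightarrow> h x \<in> h ` \<Gamma> \<longleftrightarrow> x \<in> \<Gamma>"
  using map_eq_iff by blast

text \<open>Injectivity of \<open>h\<close> transfers every clause both ways. Points give clans of
  \<open>A'\<close> by one direction, and clans of \<open>A'\<close> come from points by the
  other.\<close>

lemma clan_image_iff:
  assumes R: "\<And>x y. \<lbrakk>x \<in> carrier A; y \<in> carrier A\<rbrakk> \<Longrightarrow> R' (h x) (h y) = R x y"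
    and \<Gamma>: "\<Gamma> \<subseteq> carrier A"
  shows "clan A' R' (h ` \<Gamma>) \<longleftrightarrow> clan A R \<Gamma>"
proof -
  have "(\<forall>a\<in>\<Gamma>. \<forall>b\<in>\<Gamma>. R' (h a) (h b)) \<longleftrightarrow> (\<forall>a\<in>\<Gamma>. \<forall>b\<in>\<Gamma>. R a b)"
    using R \<Gamma> by blast
  moreover have "(\<forall>a\<in>\<Gamma>. \<forall>b\<in>carrier A. h a \<sqsubseteq>\<^bsub>A'\<^esub> h b \<longrightarrow> b \<in> \<Gamma>) \<longleftrightarrow>
      (\<forall>a\<in>\<Gamma>. \<forall>b\<in>carrier A. a \<sqsubseteq>\<^bsub>A\<^esub> b \<longrightarrow> b \<in> \<Gamma>)"
    using \<Gamma> map_le_iff by blast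
  ultimately show ?thesis
    using \<Gamma> by (simp add: clan_def carrier_image image_mono zero one join mem_image_iff closed)
qed

lemma t_clans_image_iff: "\<Gamma> \<subseteq> carrier A \<Longrightarrow> h ` \<Gamma> \<in> t_clans A' \<longleftrightarrow> \<Gamma> \<in> t_clans A"
  by (simp add: t_clans_def clan_image_iff[where R = "Ct A"] Ct)

lemma s_clans_image_iff: "\<Gamma> \<subseteq> carrier A \<Longrightarrow> h ` \<Gamma> \<in> s_clans A' \<longleftrightarrow> \<Gamma> \<in> s_clans A"
  by (simp add: s_clans_def clan_image_iff[where R = "Cs A"] Cs)

lemma clusters_image_iff:
  assumes "\<Gamma> \<subseteq> carrier A"
  shows "h ` \<Gamma> \<in> clusters A' \<longleftrightarrow> \<Gamma> \<in> clusters A"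
proof -
  \<comment> \<open>The cluster condition ranges over non-members, so images have to commute with
    complements.\<close>
  have "carrier A' - h ` \<Gamma> = h ` (carrier A - \<Gamma>)"
    using assms bij unfolding carrier_image by (simp add: bij_betw_def inj_on_image_set_diff)
  moreover have "(\<exists>b\<in>\<Gamma>. \<not> Ct A' (h a) (h b)) \<longleftrightarrow> (\<exists>b\<in>\<Gamma>. \<not> Ct A a b)" if "a \<in> carrier A" for a
    using assms Ct that by blast
  ultimately show ?thesis
    using assms by (simp add: clusters_def t_clans_image_iff)
qed

end


subsection \<open>The canonical space\<close>

context dynamic_contact_algebra
begin

lemma prime_filter_t_clan: "prime_filter U \<Longrightarrow> U \<in> t_clans A"
  by (simp add: t_clans_def time.prime_filter_clan)

lemma prime_filter_s_clan: "prime_filter U \<Longrightarrow> U \<in> s_clans A"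
  by (simp add: s_clans_def space.prime_filter_clan)

lemma s_clans_subset_t_clans: "s_clans A \<subseteq> t_clans A"
proof
  fix \<Gamma> assume "\<Gamma> \<in> s_clans A"
  then have \<Gamma>: "clan A (Cs A) \<Gamma>" by (simp add: s_clans_def)
  then have "Ct A a b" if "a \<in> \<Gamma>" "b \<in> \<Gamma>" for a b
    using that by (intro Cs_imp_Ct) (auto simp: clan_def)
  with \<Gamma> show "\<Gamma> \<in> t_clans A"
    by (simp add: t_clans_def clan_def)
qed

text \<open>This is where \<open>zero_neq_one\<close> enters; nonemptiness of all three sets of
  points follows from it.\<close>

lemma prime_filter_nonempty: obtains U where "prime_filter U"
  using prime_filter_above[OF one_closed] zero_neq_one by auto

lemma cluster_exists: "clusters A \<noteq> {}"
proof -
  obtain U where U: "prime_filter U"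
    by (rule prime_filter_nonempty)
  then have UB: "U \<subseteq> carrier A" and U1: "\<one> \<in> U"
    and Um: "\<And>u v. u \<in> U \<Longrightarrow> v \<in> U \<Longrightarrow> u \<sqinter> v \<in> U"
    unfolding prime_filter_def by auto
  define K where "K = {a \<in> carrier A. \<forall>u\<in>U. Ct A a u}"
  have UK: "U \<subseteq> K"
    unfolding K_def using UB U time.prime_filter_rel by blast
  have "clan A (Ct A) K"
    unfolding clan_def
  proof (intro conjI ballI impI)
    show "K \<subseteq> carrier A" unfolding K_def by blast
    show "\<one> \<in> K" using U1 UK by blast
    show "\<zero> \<notin> K" unfolding K_def using time.nonzero closed U1 by blast
    show "b \<in> K" if "a \<in> K" "b \<in> carrier A" "a \<sqsubseteq> b" for a b
      using that UB time.mono bool_le_refl unfolding K_def by blast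
    \<comment> \<open>If \<open>a\<close> and \<open>b\<close> miss \<open>u\<close> and
      \<open>v\<close> in \<open>U\<close>, then their join misses \<open>u \<sqinter> v\<close>,
      which is in \<open>U\<close>.\<close>
    show "a \<in> K \<or> b \<in> K" if "a \<in> carrier A" "b \<in> carrier A" "a \<squnion> b \<in> K" for a b
      using that UB Um time.not_rel_join_left unfolding K_def by blast
    show "Ct A a b" if ab: "a \<in> K" "b \<in> K" for a b
    proof (rule ccontr)
      have K: "a \<in> carrier A" "b \<in> carrier A" "\<forall>u\<in>U. Ct A a u" "\<forall>u\<in>U. Ct A b u"
        using ab by (auto simp: K_def)
      assume "\<not> Ct A a b"
      \<comment> \<open>The interpolant decides the matter: \<open>c\<close> cannot lie in
        \<open>U\<close> because of \<open>a\<close>, so \<open>\<sim> c\<close> does, contradicting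
        the choice of \<open>b\<close>.\<close>
      then obtain c where c: "c \<in> carrier A" "\<not> Ct A a c" "\<not> Ct A (\<sim> c) b"
        using Ct_Ct K by blast
      then have "\<sim> c \<in> U"
        using K prime_filter_compl_iff[OF U c(1)] by blast
      then show False
        using K c time.symmetric[OF K(2) compl_closed[OF c(1)]] by blast
    qed
  qed
  \<comment> \<open>An element outside \<open>K\<close> fails contact with some \<open>u\<close> in
    \<open>U\<close>, and \<open>U \<subseteq> K\<close> makes that \<open>u\<close> the required
    witness.\<close>
  then have "K \<in> clusters A"
    unfolding clusters_def t_clans_def using UK by (auto simp: K_def)
  then show ?thesis by blast
qed

section \<open>The Stone map and the canonical topology\<close>

lemma g_subset_iff:
  assumes "a \<in> carrier A" "b \<in> carrier A"
  shows "g_map A a \<subseteq> g_map A b \<longleftrightarrow> a \<sqsubseteq> b"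
proof
  assume "g_map A a \<subseteq> g_map A b"
  \<comment> \<open>Among the t-clans the prime filters already suffice to separate
    elements.\<close>
  then show "a \<sqsubseteq> b"
    using assms prime_filter_t_clan le_iff_prime_filter unfolding g_map_def by blast
qed (use assms in \<open>auto simp: g_map_def t_clans_def clan_def\<close>)

lemma g_inj: "inj_on (g_map A) (carrier A)"
  using g_subset_iff bool_le_antisym by (simp add: inj_on_def set_eq_subset)

lemma g_zero: "g_map A \<zero> = {}"
  by (auto simp: g_map_def t_clans_def clan_def)

lemma g_one: "g_map A \<one> = t_clans A"
  by (auto simp: g_map_def t_clans_def clan_def)

lemma g_mem_iff: "\<Gamma> \<in> t_clans A \<Longrightarrow> \<Gamma> \<in> g_map A a \<longleftrightarrow> a \<in> \<Gamma>"
  by (simp add: g_map_def)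

lemma g_subset: "g_map A a \<subseteq> t_clans A"
  by (auto simp: g_map_def)

text \<open>A t-clan may contain both \<open>a\<close> and \<open>\<sim> a\<close>, so
  \<open>g_map A (\<sim> a)\<close> can exceed the complement of \<open>g_map A a\<close>. It is
  nevertheless the least closed set around it, because prime filters contain exactly one of the
  two.\<close>

lemma closure_of_compl_g:
  assumes a: "a \<in> carrier A"
  shows "canonical_topology A closure_of (t_clans A - g_map A a) = g_map A (\<sim> a)"
proof
  have cover: "t_clans A = g_map A a \<union> g_map A (\<sim> a)"
    using a by (metis closed(3) g_join g_one join_compl)
  show "canonical_topology A closure_of (t_clans A - g_map A a) \<subseteq> g_map A (\<sim> a)"
    using closed_base_canonical_topology a closed cover
    by (intro closure_of_minimal) (auto simp: closed_base_def)
  \<comment> \<open>It suffices to test \<open>\<sim> a \<sqsubseteq> c\<close> on prime filters;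
    one that contains \<open>\<sim> a\<close> omits \<open>a\<close> and so lies in
    \<open>g_map A c\<close>.\<close>
  have le: "g_map A (\<sim> a) \<subseteq> g_map A c"
    if c: "c \<in> carrier A" "t_clans A - g_map A a \<subseteq> g_map A c" for c
  proof -
    have "c \<in> U" if "prime_filter U" "\<sim> a \<in> U" for U
      using that c a prime_filter_t_clan[of U] prime_filter_compl_iff[of U a] by (auto simp: g_map_def)
    then show ?thesis
      using a c by (simp add: g_subset_iff le_iff_prime_filter closed)
  qed
  \<comment> \<open>The closure is an intersection of base sets, each of which contains the
    complement and is handled by \<open>le\<close>.\<close>
  obtain N where N: "N \<subseteq> g_map A ` carrier A"
    "canonical_topology A closure_of (t_clans A - g_map A a) = t_clans A \<inter> \<Inter>N"
    using closed_base_canonical_topology closedin_closure_of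
    unfolding closed_base_def topspace_canonical_topology by meson
  have sub: "t_clans A - g_map A a \<subseteq> canonical_topology A closure_of (t_clans A - g_map A a)"
    by (intro closure_of_subset) (auto simp: topspace_canonical_topology)
  have "g_map A (\<sim> a) \<subseteq> C" if C: "C \<in> N" for C
  proof -
    obtain c where "c \<in> carrier A" "C = g_map A c"
      using N(1) C by auto
    moreover have "t_clans A - g_map A a \<subseteq> C"
      using sub C unfolding N(2) by blast
    ultimately show ?thesis
      using le by simp
  qed
  then show "g_map A (\<sim> a) \<subseteq> canonical_topology A closure_of (t_clans A - g_map A a)"
    using N(2) g_subset by auto
qed

lemma interior_of_g:
  "a \<in> carrier A \<Longrightarrow> canonical_topology A interior_of (g_map A a) = t_clans A - g_map A (\<sim> a)"
  by (simp add: interior_of_closure_of topspace_canonical_topology closure_of_compl_g)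

text \<open>A t-clan can contain \<open>a\<close> and \<open>b\<close> without
  \<open>a \<sqinter> b\<close>, so the plain intersection may be too large. Its interior is the
  complement of \<open>g_map A (\<sim> a \<squnion> \<sim> b)\<close>, whose closure is computed by
  De Morgan.\<close>

lemma g_meet:
  assumes "a \<in> carrier A" "b \<in> carrier A"
  shows "canonical_topology A closure_of
    (canonical_topology A interior_of (g_map A a \<inter> g_map A b)) = g_map A (a \<sqinter> b)"
proof -
  have "canonical_topology A interior_of (g_map A a \<inter> g_map A b) =
      t_clans A - g_map A (\<sim> a \<squnion> \<sim> b)"
    using assms by (auto simp: interior_of_Int interior_of_g g_join closed)
  then show ?thesis
    using assms by (simp add: closure_of_compl_g closed compl_join_compl)
qed

lemma regular_closed_g: "a \<in> carrier A \<Longrightarrow> regular_closed (canonical_topology A) (g_map A a)"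
  using g_meet[of a a] by (simp add: regular_closed_def meet_idem)

text \<open>The interior contains a nonempty basic open set, the complement of some
  \<open>g_map A c\<close>. Then \<open>c\<close> is not the unit, and a prime filter omitting
  \<open>c\<close> is an s-clan in that open set.\<close>

lemma regular_closed_meets_s_clans:
  assumes F: "regular_closed (canonical_topology A) F" "F \<noteq> {}"
  shows "F \<inter> s_clans A \<noteq> {}"
proof -
  let ?X = "canonical_topology A"
  let ?G = "t_clans A - ?X interior_of F"
  have "closedin ?X ?G"
    by (metis closedin_diff closedin_topspace openin_interior_of topspace_canonical_topology)
  then obtain N where N: "N \<subseteq> g_map A ` carrier A" "?G = t_clans A \<inter> \<Inter>N"
    using closed_base_canonical_topology
    unfolding closed_base_def topspace_canonical_topology by meson
  \<comment> \<open>A regular closed set is the closure of its interior, so an empty interior would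
    make \<open>F\<close> empty.\<close>
  have "?X interior_of F \<noteq> {}"
    using F by (metis closure_of_empty regular_closed_def)
  moreover have "?X interior_of F \<subseteq> t_clans A"
    by (metis interior_of_subset_topspace topspace_canonical_topology)
  ultimately obtain \<Gamma> where "\<Gamma> \<in> t_clans A" "\<Gamma> \<notin> ?G"
    by auto
  then obtain C where "C \<in> N" "\<Gamma> \<notin> C"
    using N(2) by auto
  moreover from this obtain c where "c \<in> carrier A" "C = g_map A c"
    using N(1) by auto
  ultimately have c: "c \<in> carrier A" "g_map A c \<noteq> t_clans A" "?G \<subseteq> g_map A c"
    using N(2) \<open>\<Gamma> \<in> t_clans A\<close> by auto
  then have "\<not> \<one> \<sqsubseteq> c"
    using g_subset_iff[of \<one> c] g_subset[of c] closed by (auto simp: g_one)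
  then obtain U where "prime_filter U" "c \<notin> U"
    using le_iff_prime_filter[of \<one> c] c closed by blast
  moreover have "?X interior_of F \<subseteq> F" by (rule interior_of_subset)
  ultimately show ?thesis
    using c(3) prime_filter_s_clan prime_filter_t_clan unfolding g_map_def by blast
qed

section \<open>Contact and precedence of regions\<close>

lemma Ct_iff_g:
  assumes "a \<in> carrier A" "b \<in> carrier A"
  shows "g_map A a \<inter> g_map A b \<noteq> {} \<longleftrightarrow> Ct A a b"
proof
  assume "Ct A a b"
  \<comment> \<open>This direction needs the existence of points: related elements share a
    clan.\<close>
  then obtain \<Gamma> where "clan A (Ct A) \<Gamma>" "a \<in> \<Gamma>" "b \<in> \<Gamma>"
    by (rule time.clan_of_rel[OF assms])
  then have "\<Gamma> \<in> g_map A a \<inter> g_map A b"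
    by (simp add: g_map_def t_clans_def)
  then show "g_map A a \<inter> g_map A b \<noteq> {}" by blast
next
  assume "g_map A a \<inter> g_map A b \<noteq> {}"
  then obtain \<Gamma> where "\<Gamma> \<in> t_clans A" "a \<in> \<Gamma>" "b \<in> \<Gamma>"
    by (auto simp: g_map_def)
  then show "Ct A a b" by (simp add: t_clans_def clan_def)
qed

lemma Cs_iff_g:
  assumes "a \<in> carrier A" "b \<in> carrier A"
  shows "g_map A a \<inter> g_map A b \<inter> s_clans A \<noteq> {} \<longleftrightarrow> Cs A a b"
proof
  assume "Cs A a b"
  then obtain \<Gamma> where \<Gamma>: "clan A (Cs A) \<Gamma>" "a \<in> \<Gamma>" "b \<in> \<Gamma>"
    by (rule space.clan_of_rel[OF assms])
  then have "\<Gamma> \<in> s_clans A"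
    by (simp add: s_clans_def)
  moreover from this have "\<Gamma> \<in> t_clans A"
    using s_clans_subset_t_clans by auto
  ultimately have "\<Gamma> \<in> g_map A a \<inter> g_map A b \<inter> s_clans A"
    using \<Gamma> by (simp add: g_map_def)
  then show "g_map A a \<inter> g_map A b \<inter> s_clans A \<noteq> {}" by blast
next
  assume "g_map A a \<inter> g_map A b \<inter> s_clans A \<noteq> {}"
  then obtain \<Gamma> where "\<Gamma> \<in> s_clans A" "a \<in> \<Gamma>" "b \<in> \<Gamma>"
    by (auto simp: g_map_def)
  then show "Cs A a b" by (simp add: s_clans_def clan_def)
qed

text \<open>Precedence relates two separate points, so the two prime filters themselves serve and no
  common clan has to be formed.\<close>

lemma Bp_iff_g:
  assumes "a \<in> carrier A" "b \<in> carrier A"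
  shows "(\<exists>\<Gamma>\<in>g_map A a. \<exists>\<Delta>\<in>g_map A b. \<forall>x\<in>\<Gamma>. \<forall>y\<in>\<Delta>. Bp A x y) \<longleftrightarrow> Bp A a b"
proof
  assume "Bp A a b"
  then obtain U V where "prime_filter U" "prime_filter V" "a \<in> U" "b \<in> V"
    "\<forall>u\<in>U. \<forall>v\<in>V. Bp A u v"
    using prec.prime_filters_of_rel assms by blast
  then show "\<exists>\<Gamma>\<in>g_map A a. \<exists>\<Delta>\<in>g_map A b. \<forall>x\<in>\<Gamma>. \<forall>y\<in>\<Delta>. Bp A x y"
    using prime_filter_t_clan unfolding g_map_def by blast
qed (auto simp: g_map_def)

lemma g_iso: "dyn_alg_iso A (region_algebra (canonical_space A)) (g_map A)"
proof
qed (auto simp: region_algebra_def canonical_space_def RC_def topspace_canonical_topology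
    g_inj[THEN inj_on_imp_bij_betw] g_join g_meet closure_of_compl_g g_zero g_one
    Cs_iff_g Ct_iff_g Bp_iff_g dynamic_contact_algebra_axioms)

text \<open>A region \<open>g_map A a\<close> contains the point \<open>\<Gamma>\<close> exactly if
  \<open>a\<close> is in \<open>\<Gamma>\<close>. Thus \<open>rho\<close> acts on points as direct
  image, the form in which clans and clusters transfer.\<close>

lemma rho_canonical_space: "\<Gamma> \<in> t_clans A \<Longrightarrow> rho (canonical_space A) \<Gamma> = g_map A ` \<Gamma>"
  by (auto simp: rho_def canonical_space_def g_map_def t_clans_def clan_def)

lemma t_clan_subset: "\<Gamma> \<in> t_clans A \<Longrightarrow> \<Gamma> \<subseteq> carrier A"
  by (simp add: t_clans_def clan_def)

lemma clusters_subset_t_clans: "clusters A \<subseteq> t_clans A"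
  by (auto simp: clusters_def)

section \<open>The space axioms, separation and compactness\<close>

lemma dynamic_mereotopological_space_canonical:
  "dynamic_mereotopological_space (canonical_space A)"
proof -
  interpret g: dyn_alg_iso A "region_algebra (canonical_space A)" "g_map A" by (rule g_iso)
  have sel: "Xt (canonical_space A) = canonical_topology A" "Xs (canonical_space A) = s_clans A"
    "XT (canonical_space A) = clusters A" "regions (canonical_space A) = g_map A ` carrier A"
    "before (canonical_space A) = (\<lambda>\<Gamma> \<Delta>. \<forall>a\<in>\<Gamma>. \<forall>b\<in>\<Delta>. Bp A a b)"
    by (simp_all add: canonical_space_def)
  show ?thesis
  proof (intro dynamic_mereotopological_space.intro, unfold sel topspace_canonical_topology)
    show "t_clans A \<noteq> {}" "clusters A \<noteq> {}" "clusters A \<subseteq> t_clans A"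
      using cluster_exists clusters_subset_t_clans by auto
    show "s_clans A \<noteq> {}"
      using prime_filter_s_clan prime_filter_nonempty by auto
    show "bool_subalgebra (g_map A ` carrier A) (RC (canonical_topology A))"
      \<comment> \<open>These instances show that the empty set and the whole space are regions,
        once \<open>g_zero\<close> and \<open>g_one\<close> rewrite them.\<close>
      using imageI[OF zero_closed, of "g_map A"] imageI[OF one_closed, of "g_map A"]
      by (auto simp: bool_subalgebra_def RC_def regular_closed_g closure_of_compl_g g_meet closed
          topspace_canonical_topology g_zero g_one simp flip: g_join)
    show "(\<forall>x\<in>\<Gamma>. \<forall>y\<in>\<Delta>. Bp A x y) \<longleftrightarrow>
        (\<forall>a\<in>g_map A ` carrier A. \<forall>b\<in>g_map A ` carrier A. \<Gamma> \<in> a \<longrightarrow> \<Delta> \<in> b \<longrightarrow>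
          Bp (region_algebra (canonical_space A)) a b)"
      if "\<Gamma> \<in> t_clans A" "\<Delta> \<in> t_clans A" for \<Gamma> \<Delta>
      using that by (auto simp: g.Bp g_mem_iff dest: subsetD[OF t_clan_subset])
    show "rho (canonical_space A) \<Gamma> \<in> clusters (region_algebra (canonical_space A))"
      if "\<Gamma> \<in> clusters A" for \<Gamma>
      using that t_clan_subset[of \<Gamma>] subsetD[OF clusters_subset_t_clans that]
      by (simp add: rho_canonical_space g.clusters_image_iff)
  qed (rule closed_base_canonical_topology s_clans_subset_t_clans
      g.dynamic_contact_algebra_image regular_closed_meets_s_clans; assumption)+
qed

text \<open>Distinct t-clans differ in some element \<open>a\<close>; the complement of
  \<open>g_map A a\<close> is open and contains just the one that omits \<open>a\<close>.\<close>

lemma t0_space_canonical: "t0_space (canonical_topology A)"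
proof -
  have sep: "\<exists>U. openin (canonical_topology A) U \<and> \<Gamma> \<notin> U \<and> \<Delta> \<in> U"
    if "\<Gamma> \<in> t_clans A" "\<Delta> \<in> t_clans A" "a \<in> \<Gamma>" "a \<notin> \<Delta>" for \<Gamma> \<Delta> a
  proof (intro exI conjI)
    have "a \<in> carrier A" using that t_clan_subset by blast
    then show "openin (canonical_topology A) (t_clans A - g_map A a)"
      using closed_base_canonical_topology
      by (simp add: closed_base_def closedin_def topspace_canonical_topology)
  qed (use that in \<open>auto simp: g_map_def\<close>)
  show ?thesis
    unfolding t0_space_def topspace_canonical_topology
    using sep by (metis subsetI subset_antisym)
qed

text \<open>A clan or cluster of the region algebra is the image of a set of elements of
  \<open>A\<close>. By transfer that set is of the same kind, so it is itself the required
  point.\<close>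

lemma DM_compact_canonical: "DM_compact (canonical_space A)"
proof -
  interpret g: dyn_alg_iso A "region_algebra (canonical_space A)" "g_map A" by (rule g_iso)
  let ?A' = "region_algebra (canonical_space A)"
  have pre: "\<exists>\<Gamma>\<subseteq>carrier A. \<Gamma>' = g_map A ` \<Gamma>"
    if "\<Gamma>' \<in> t_clans ?A' \<or> \<Gamma>' \<in> s_clans ?A' \<or> \<Gamma>' \<in> clusters ?A'" for \<Gamma>'
  proof -
    have "\<Gamma>' \<subseteq> carrier ?A'"
      using that by (auto simp: t_clans_def s_clans_def clusters_def clan_def)
    then show ?thesis unfolding g.carrier_image by (auto simp: subset_image_iff)
  qed
  have "\<exists>\<Gamma>\<in>t_clans A. \<Gamma>' = rho (canonical_space A) \<Gamma>" if "\<Gamma>' \<in> t_clans ?A'" for \<Gamma>'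
    using pre[of \<Gamma>'] that g.t_clans_image_iff rho_canonical_space by metis
  moreover have "\<exists>\<Gamma>\<in>s_clans A. \<Gamma>' = rho (canonical_space A) \<Gamma>" if "\<Gamma>' \<in> s_clans ?A'" for \<Gamma>'
    using pre[of \<Gamma>'] that g.s_clans_image_iff rho_canonical_space s_clans_subset_t_clans
    by (metis subsetD)
  moreover have "\<exists>\<Gamma>\<in>clusters A. \<Gamma>' = rho (canonical_space A) \<Gamma>" if "\<Gamma>' \<in> clusters ?A'" for \<Gamma>'
    using pre[of \<Gamma>'] that g.clusters_image_iff rho_canonical_space clusters_subset_t_clans
    by (metis subsetD)
  ultimately show ?thesis
    unfolding DM_compact_def by (simp add: canonical_space_def topspace_canonical_topology)
qed

end

theorem theorem5p25:
  fixes A :: "'a dyn_alg"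
  assumes "dynamic_contact_algebra A"
  shows "dynamic_mereotopological_space (canonical_space A)
    \<and> t0_space (Xt (canonical_space A))
    \<and> DM_compact (canonical_space A)"
proof -
  interpret dynamic_contact_algebra A by (rule assms)
  show ?thesis
    using dynamic_mereotopological_space_canonical t0_space_canonical DM_compact_canonical
    by (simp add: canonical_space_def)
qed

end
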